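(* Let $k$ be a field and let $\mathfrak{g}\subseteq\mathfrak{h}$ be a radical extension of finite dimensional Lie algebras over $k$. Then the Galois group $\mathrm{Gal}(\mathfrak{h}/\mathfrak{g})$ is solvable.
   Context: Galois group: for a Lie subalgebra $\mathfrak{g}$ of a Lie algebra $\mathfrak{h}$, $\mathrm{Gal}(\mathfrak{h}/\mathfrak{g}):=\{\sigma\in\mathrm{Aut}_{\mathrm{Lie}}(\mathfrak{h})\mid\sigma(g)=g\ \forall g\in\mathfrak{g}\}$. An extension $\mathfrak{g}\subseteq\mathfrak{h}$ of Lie algebras is called a radical extension if there exists a finite chain of Lie subalgebras of $\mathfrak{h}$ $$\mathfrak{g}=\mathfrak{h}_0\subset\mathfrak{h}_1\subset\cdots\subset\mathfrak{h}_m=\mathfrak{h}$$ such that $\mathfrak{h}_i$ has codimension $1$ in $\mathfrak{h}_{i+1}$ for all $i=0,\dots,m-1$, and such that $\tau(\mathfrak{h}_{i-1})\subseteq\mathfrak{h}_{i-1}$ for all $\tau\in\mathrm{Gal}(\mathfrak{h}_i/\mathfrak{g})$ and all $i=1,\dots,m$. *)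

theory Defs
  imports Complex_Main "HOL-Algebra.Bij" "HOL-Algebra.Solvable_Groups"
begin

text \<open>Alternation is \<open>[x, x] = 0\<close> rather than skew-symmetry, so that the definition is the
  right one in characteristic 2 as well. No restriction is put on the dimension of the type:
  the Lie algebras of interest are the subalgebras, given as sets.\<close>

locale lie_algebra = vector_space scale
  for scale :: "'k::field \<Rightarrow> 'a::ab_group_add \<Rightarrow> 'a" (infixr \<open>*s\<close> 75) +
  fixes bracket :: "'a \<Rightarrow> 'a \<Rightarrow> 'a"
  assumes bracket_add_left: "bracket (x + y) z = bracket x z + bracket y z"
    and bracket_add_right: "bracket x (y + z) = bracket x y + bracket x z"
    and bracket_scale_left: "bracket (c *s x) y = c *s bracket x y"
    and bracket_scale_right: "bracket x (c *s y) = c *s bracket x y"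
    and bracket_self: "bracket x x = 0"
    and jacobi: "bracket x (bracket y z) + bracket y (bracket z x) + bracket z (bracket x y) = 0"
begin

definition lie_subalgebra :: "'a set \<Rightarrow> bool" where
  "lie_subalgebra V \<longleftrightarrow> subspace V \<and> (\<forall>x\<in>V. \<forall>y\<in>V. bracket x y \<in> V)"

definition finite_dim :: "'a set \<Rightarrow> bool" where
  "finite_dim V \<longleftrightarrow> (\<exists>B. finite B \<and> B \<subseteq> V \<and> span B = V)"

text \<open>For subspaces \<open>U \<subseteq> V\<close>, the quotient \<open>V / U\<close> has dimension \<open>n\<close>:
  the classes modulo \<open>U\<close> of the \<open>n\<close> elements of \<open>B\<close> form a basis of \<open>V / U\<close>.
  Unlike a difference of dimensions, this is meaningful when \<open>U\<close> and \<open>V\<close>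
  are infinite dimensional.\<close>

definition has_codim :: "'a set \<Rightarrow> 'a set \<Rightarrow> nat \<Rightarrow> bool" where
  "has_codim U V n \<longleftrightarrow> U \<subseteq> V \<and>
     (\<exists>B. finite B \<and> card B = n \<and> B \<subseteq> V \<and> span (U \<union> B) = V \<and>
        (\<forall>c. (\<Sum>b\<in>B. c b *s b) \<in> U \<longrightarrow> (\<forall>b\<in>B. c b = 0)))"

text \<open>Automorphisms of \<open>V\<close> are functions on the whole type; membership in \<open>Bij V\<close> makes them
  \<open>undefined\<close> outside \<open>V\<close>, so that each automorphism of \<open>V\<close> is represented exactly once.\<close>

definition lie_auts :: "'a set \<Rightarrow> ('a \<Rightarrow> 'a) set" where
  "lie_auts V = {\<sigma> \<in> Bij V.
     (\<forall>x\<in>V. \<forall>y\<in>V. \<sigma> (x + y) = \<sigma> x + \<sigma> y) \<and>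
     (\<forall>c. \<forall>x\<in>V. \<sigma> (c *s x) = c *s \<sigma> x) \<and>
     (\<forall>x\<in>V. \<forall>y\<in>V. \<sigma> (bracket x y) = bracket (\<sigma> x) (\<sigma> y))}"

definition lie_gal :: "'a set \<Rightarrow> 'a set \<Rightarrow> ('a \<Rightarrow> 'a) monoid" where
  "lie_gal V U = (BijGroup V)\<lparr>carrier := {\<sigma> \<in> lie_auts V. \<forall>x\<in>U. \<sigma> x = x}\<rparr>"

definition radical_extension :: "'a set \<Rightarrow> 'a set \<Rightarrow> bool" where
  "radical_extension U V \<longleftrightarrow>
     (\<exists>m. \<exists>H :: nat \<Rightarrow> 'a set. H 0 = U \<and> H m = V \<and>
        (\<forall>i\<le>m. lie_subalgebra (H i)) \<and>
        (\<forall>i<m. has_codim (H i) (H (Suc i)) 1) \<and>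
        (\<forall>i\<in>{1..m}. \<forall>\<tau>\<in>carrier (lie_gal (H i) U). \<tau> ` H (i - 1) \<subseteq> H (i - 1)))"

lemma lie_gal_subgroup:
  assumes V: "lie_subalgebra V" and UV: "U \<subseteq> V"
  shows "subgroup (carrier (lie_gal V U)) (BijGroup V)"
proof -
  interpret G: group "BijGroup V" by (rule group_BijGroup)
  have closed: "x + y \<in> V" "c *s x \<in> V" "bracket x y \<in> V" if "x \<in> V" "y \<in> V" for x y c
    using V that by (auto simp: lie_subalgebra_def subspace_def)
  have sub: "carrier (lie_gal V U) \<subseteq> Bij V"
    by (auto simp: lie_gal_def lie_auts_def)
  show ?thesis
  proof (rule G.subgroupI)
    show "carrier (lie_gal V U) \<subseteq> carrier (BijGroup V)"
      using sub by (simp add: BijGroup_def)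
    have "(\<lambda>x\<in>V. x) \<in> carrier (lie_gal V U)"
      using UV closed id_Bij[of V] by (auto simp: lie_gal_def lie_auts_def)
    then show "carrier (lie_gal V U) \<noteq> {}" by blast
  next
    fix s assume s: "s \<in> carrier (lie_gal V U)"
    then have sB: "s \<in> Bij V" using sub by blast
    then have bij: "bij_betw s V V" by (simp add: Bij_def)
    have im: "inv_into V s x \<in> V" "s (inv_into V s x) = x" if "x \<in> V" for x
      using sB bij that by (auto simp: Bij_inv_into_mem bij_betw_inv_into_right)
    have eq: "inv_into V s x = y" if "y \<in> V" "s y = x" for x y
      using bij that by (metis bij_betw_inv_into_left)
    have "restrict (inv_into V s) V \<in> lie_auts V"
      using s im closed restrict_inv_into_Bij[OF sB]
      by (auto simp: lie_gal_def lie_auts_def intro!: eq)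
    moreover have "\<forall>x\<in>U. restrict (inv_into V s) V x = x"
      using s UV by (auto simp: lie_gal_def intro!: eq)
    ultimately show "inv\<^bsub>BijGroup V\<^esub> s \<in> carrier (lie_gal V U)"
      by (simp add: inv_BijGroup[OF sB] lie_gal_def)
  next
    fix s t assume s: "s \<in> carrier (lie_gal V U)" and t: "t \<in> carrier (lie_gal V U)"
    then have B: "s \<in> Bij V" "t \<in> Bij V" using sub by auto
    then have "\<And>x. x \<in> V \<Longrightarrow> t x \<in> V" using Bij_imp_funcset by blast
    then have "compose V s t \<in> carrier (lie_gal V U)"
      using s t UV closed compose_Bij[OF B]
      by (auto simp: lie_gal_def lie_auts_def compose_eq subset_iff)
    then show "s \<otimes>\<^bsub>BijGroup V\<^esub> t \<in> carrier (lie_gal V U)"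
      using B by (simp add: BijGroup_def)
  qed
qed

lemma group_lie_gal:
  assumes "lie_subalgebra V" and "U \<subseteq> V"
  shows "group (lie_gal V U)"
proof -
  have "lie_gal V U = (BijGroup V)\<lparr>carrier := carrier (lie_gal V U)\<rparr>"
    by (simp add: lie_gal_def)
  then show ?thesis
    using subgroup.subgroup_is_group[OF lie_gal_subgroup[OF assms] group_BijGroup] by simp
qed

end

end

(* Restricting automorphisms along the chain gives homomorphisms
   Gal(h_(i+1)/g) -> Gal(h_i/g) with kernel Gal(h_(i+1)/h_i), so by induction it suffices that
   Gal(V/U) is solvable when U has codimension 1 in V. There every automorphism fixing U acts on
   the line V/U by a scalar, so commutators act trivially on V/U; and the automorphisms that act
   trivially on both U and V/U commute with each other. *)

theory Submission
  imports Defs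
begin

text \<open>Commutativity makes the derived subgroup of \<open>H\<close> trivial, so the derived
  series reaches \<open>{\<one>}\<close> after the single step passed as \<open>1\<close>.\<close>

lemma (in group) solvable_seq_commuting:
  assumes H: "subgroup H G" and comm: "\<And>x y. x \<in> H \<Longrightarrow> y \<in> H \<Longrightarrow> x \<otimes> y = y \<otimes> x"
  shows "solvable_seq G H"
proof -
  interpret H: comm_group "G\<lparr>carrier := H\<rparr>"
    using group.group_comm_groupI[OF subgroup_imp_group[OF H]] comm by simp
  have "derived G H = {\<one>}"
    using H.derived_eq_singleton[of H] derived_consistent[OF _ H, of H] by simp
  then show ?thesis
    using trivial_derived_seq_imp_solvable[OF H, of 1] by simp
qed

context lie_algebra
begin

section \<open>Elementary calculus of relative automorphisms\<close>

lemma lie_subalgebra_closed: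
  assumes "lie_subalgebra V" "x \<in> V" "y \<in> V"
  shows "x + y \<in> V" "x - y \<in> V" "- x \<in> V" "c *s x \<in> V" "bracket x y \<in> V"
  using assms by (auto simp: lie_subalgebra_def subspace_add subspace_diff subspace_neg subspace_scale)

lemma lie_galD:
  assumes s: "s \<in> carrier (lie_gal V U)" and V: "lie_subalgebra V"
  shows lie_gal_Bij: "s \<in> Bij V"
    and lie_gal_bij_betw: "bij_betw s V V"
    and lie_gal_closed: "x \<in> V \<Longrightarrow> s x \<in> V"
    and lie_gal_add: "x \<in> V \<Longrightarrow> y \<in> V \<Longrightarrow> s (x + y) = s x + s y"
    and lie_gal_scale: "x \<in> V \<Longrightarrow> s (c *s x) = c *s s x"
    and lie_gal_bracket: "x \<in> V \<Longrightarrow> y \<in> V \<Longrightarrow> s (bracket x y) = bracket (s x) (s y)"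
    and lie_gal_fix: "x \<in> U \<Longrightarrow> s x = x"
  using s Bij_imp_funcset[of s V] by (auto simp: lie_gal_def lie_auts_def Bij_def)

lemma lie_gal_diff:
  assumes "s \<in> carrier (lie_gal V U)" "lie_subalgebra V" "x \<in> V" "y \<in> V"
  shows "s (x - y) = s x - s y"
  using lie_gal_add[OF assms(1,2), of "x - y" y] lie_subalgebra_closed[OF assms(2-4)] assms(4)
  by (simp add: algebra_simps)

lemma lie_gal_mult:
  assumes "s \<in> carrier (lie_gal V U)" "t \<in> carrier (lie_gal V U)"
  shows "s \<otimes>\<^bsub>lie_gal V U\<^esub> t = compose V s t"
  using assms by (auto simp: lie_gal_def lie_auts_def BijGroup_def)

lemma lie_gal_one: "\<one>\<^bsub>lie_gal V U\<^esub> = (\<lambda>x\<in>V. x)"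
  by (simp add: lie_gal_def BijGroup_def)

lemma lie_gal_inv_cancel:
  assumes V: "lie_subalgebra V" and UV: "U \<subseteq> V" and s: "s \<in> carrier (lie_gal V U)"
    and x: "x \<in> V"
  shows "s ((inv\<^bsub>lie_gal V U\<^esub> s) x) = x"
proof -
  interpret G: group "lie_gal V U" using group_lie_gal[OF V UV] .
  have "compose V s (inv\<^bsub>lie_gal V U\<^esub> s) = (\<lambda>x\<in>V. x)"
    using G.r_inv[OF s] by (simp add: lie_gal_mult s lie_gal_one)
  then show ?thesis using x by (metis compose_eq restrict_apply')
qed

text \<open>Members of \<open>Bij V\<close> are \<open>undefined\<close> outside \<open>V\<close>,
  so their values on \<open>V\<close> determine them.\<close>

lemma lie_gal_eqI:
  assumes "s \<in> carrier (lie_gal V U)" "t \<in> carrier (lie_gal V U)" "lie_subalgebra V"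
    and "\<And>x. x \<in> V \<Longrightarrow> s x = t x"
  shows "s = t"
  using assms lie_gal_Bij Bij_imp_extensional by (metis extensionalityI)

section \<open>Extensions of codimension one\<close>

lemma has_codim_oneE:
  assumes "has_codim U V 1" and U: "lie_subalgebra U"
  obtains b where "b \<in> V" "b \<notin> U" "\<And>x. x \<in> V \<Longrightarrow> \<exists>c. x - c *s b \<in> U"
proof -
  from assms(1) obtain B where B: "card B = 1" "B \<subseteq> V" "span (U \<union> B) = V"
    "\<forall>c. (\<Sum>b\<in>B. c b *s b) \<in> U \<longrightarrow> (\<forall>b\<in>B. c b = 0)"
    unfolding has_codim_def by blast
  then obtain b where b: "B = {b}" by (auto simp: card_1_singleton_iff)
  \<comment> \<open>The coefficient is taken to be 1: if \<open>b\<close> lay in \<open>U\<close>,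
    independence modulo \<open>U\<close> would force 1 = 0.\<close>
  have "b \<notin> U" using B(4)[rule_format, of "\<lambda>_. 1"] b by auto
  moreover have "\<exists>c. x - c *s b \<in> U" if "x \<in> V" for x
  proof -
    have "x \<in> span (insert b U)" using that B(3) b by simp
    moreover have "span U = U" using U by (simp add: lie_subalgebra_def span_eq_iff)
    ultimately show ?thesis by (auto simp: span_insert)
  qed
  ultimately show thesis using that B(2) b by blast
qed

text \<open>This is the kernel of the action on V/U. For such \<open>s\<close>, the map s - 1 sends
  \<open>V\<close> into \<open>U\<close> and kills \<open>U\<close>, so it squares to zero and
  \<open>s\<close> is unipotent.\<close>

definition lie_gal_unip :: "'a set \<Rightarrow> 'a set \<Rightarrow> ('a \<Rightarrow> 'a) set" where
  "lie_gal_unip V U = {s \<in> carrier (lie_gal V U). \<forall>x\<in>V. s x - x \<in> U}"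

lemma subgroup_lie_gal_unip:
  assumes V: "lie_subalgebra V" and U: "lie_subalgebra U" and UV: "U \<subseteq> V"
  shows "subgroup (lie_gal_unip V U) (lie_gal V U)"
proof -
  interpret G: group "lie_gal V U" using group_lie_gal[OF V UV] .
  show ?thesis
  proof (rule G.subgroupI)
    show "lie_gal_unip V U \<subseteq> carrier (lie_gal V U)" by (auto simp: lie_gal_unip_def)
    have "\<one>\<^bsub>lie_gal V U\<^esub> \<in> lie_gal_unip V U"
      using G.one_closed U
      by (simp add: lie_gal_unip_def lie_gal_one lie_subalgebra_def subspace_0)
    then show "lie_gal_unip V U \<noteq> {}" by blast
  next
    fix s assume s: "s \<in> lie_gal_unip V U"
    then have sG: "s \<in> carrier (lie_gal V U)" by (simp add: lie_gal_unip_def)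
    have "(inv\<^bsub>lie_gal V U\<^esub> s) x - x \<in> U" if x: "x \<in> V" for x
    proof -
      let ?y = "(inv\<^bsub>lie_gal V U\<^esub> s) x"
      have "?y \<in> V" using lie_gal_closed[OF G.inv_closed[OF sG] V x] .
      \<comment> \<open>Triviality of \<open>s\<close> on V/U is applied at the preimage
        \<open>?y\<close> of \<open>x\<close>; negation then gives the claim for the
        inverse.\<close>
      then have "s ?y - ?y \<in> U" using s by (simp add: lie_gal_unip_def)
      then have "- (x - ?y) \<in> U"
        using lie_gal_inv_cancel[OF V UV sG x] lie_subalgebra_closed(3)[OF U] by metis
      then show ?thesis by simp
    qed
    then show "inv\<^bsub>lie_gal V U\<^esub> s \<in> lie_gal_unip V U"
      using sG by (simp add: lie_gal_unip_def)
  next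
    fix s t assume st: "s \<in> lie_gal_unip V U" "t \<in> lie_gal_unip V U"
    then have G: "s \<in> carrier (lie_gal V U)" "t \<in> carrier (lie_gal V U)"
      by (simp_all add: lie_gal_unip_def)
    have "s (t x) - x \<in> U" if x: "x \<in> V" for x
    proof -
      have "s (t x) - t x \<in> U" "t x - x \<in> U"
        using st x lie_gal_closed[OF G(2) V x] by (auto simp: lie_gal_unip_def)
      then have "(s (t x) - t x) + (t x - x) \<in> U" by (rule lie_subalgebra_closed(1)[OF U])
      then show ?thesis by simp
    qed
    then show "s \<otimes>\<^bsub>lie_gal V U\<^esub> t \<in> lie_gal_unip V U"
      using G.m_closed[OF G] by (simp add: lie_gal_unip_def lie_gal_mult[OF G] compose_eq)
  qed
qed

text \<open>The displacement t x - x lies in \<open>U\<close>, where \<open>s\<close> is the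
  identity. Hence s (t x) = x + (s x - x) + (t x - x), which is symmetric in \<open>s\<close> and
  \<open>t\<close>.\<close>

lemma lie_gal_unip_commute:
  assumes V: "lie_subalgebra V" and UV: "U \<subseteq> V"
    and s: "s \<in> lie_gal_unip V U" and t: "t \<in> lie_gal_unip V U"
  shows "s \<otimes>\<^bsub>lie_gal V U\<^esub> t = t \<otimes>\<^bsub>lie_gal V U\<^esub> s"
proof -
  interpret G: group "lie_gal V U" using group_lie_gal[OF V UV] .
  have *: "s (t x) = s x + (t x - x)" if s: "s \<in> lie_gal_unip V U" and t: "t \<in> lie_gal_unip V U"
    and x: "x \<in> V" for s t x
  proof -
    have sG: "s \<in> carrier (lie_gal V U)" and u: "t x - x \<in> U"
      using s t x by (auto simp: lie_gal_unip_def)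
    have "s (x + (t x - x)) = s x + s (t x - x)"
      using lie_gal_add[OF sG V x] u UV by blast
    then show ?thesis using lie_gal_fix[OF sG V u] by simp
  qed
  have G: "s \<in> carrier (lie_gal V U)" "t \<in> carrier (lie_gal V U)"
    using s t by (simp_all add: lie_gal_unip_def)
  show ?thesis
  proof (rule lie_gal_eqI[OF G.m_closed[OF G] G.m_closed[OF G(2,1)] V])
    fix x assume "x \<in> V"
    then show "(s \<otimes>\<^bsub>lie_gal V U\<^esub> t) x = (t \<otimes>\<^bsub>lie_gal V U\<^esub> s) x"
      using *[OF s t] *[OF t s] G by (simp add: lie_gal_mult compose_eq)
  qed
qed

text \<open>Automorphisms act on the line V/U by nonzero scalars. These multiply under composition
  and commute in the field, so a commutator acts by 1.\<close>

lemma commutator_in_lie_gal_unip: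
  assumes V: "lie_subalgebra V" and U: "lie_subalgebra U" and codim: "has_codim U V 1"
    and s: "s \<in> carrier (lie_gal V U)" and t: "t \<in> carrier (lie_gal V U)"
  shows "s \<otimes>\<^bsub>lie_gal V U\<^esub> t \<otimes>\<^bsub>lie_gal V U\<^esub> inv\<^bsub>lie_gal V U\<^esub> s \<otimes>\<^bsub>lie_gal V U\<^esub> inv\<^bsub>lie_gal V U\<^esub> t
    \<in> lie_gal_unip V U" (is "?k \<in> _")
proof -
  have UV: "U \<subseteq> V" using codim by (simp add: has_codim_def)
  interpret G: group "lie_gal V U" using group_lie_gal[OF V UV] .
  obtain b where b: "b \<in> V" "b \<notin> U" and line: "\<And>x. x \<in> V \<Longrightarrow> \<exists>c. x - c *s b \<in> U"
    using has_codim_oneE[OF codim U] by blast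
  have k: "?k \<in> carrier (lie_gal V U)" using s t by simp
  have scalar: "\<exists>c. c \<noteq> 0 \<and> r b - c *s b \<in> U" if r: "r \<in> carrier (lie_gal V U)" for r
  proof -
    obtain c where c: "r b - c *s b \<in> U" using line lie_gal_closed[OF r V b(1)] by blast
    \<comment> \<open>If \<open>c\<close> were 0, then \<open>r b\<close> would lie in
      \<open>U\<close> and be fixed by \<open>r\<close>; injectivity would give
      \<open>r b = b\<close>, contradicting that \<open>b\<close> is not in
      \<open>U\<close>.\<close>
    have "c \<noteq> 0"
    proof
      assume "c = 0"
      then have "r b \<in> U" using c by simp
      moreover have "r (r b) = r b" using lie_gal_fix[OF r V] calculation .
      ultimately have "r b = b"
        using lie_gal_bij_betw[OF r V] b UV by (metis bij_betw_def inj_onD subsetD)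
      then show False using \<open>r b \<in> U\<close> b by simp
    qed
    then show ?thesis using c by blast
  qed
  obtain c d where c: "c \<noteq> 0" "s b - c *s b \<in> U" and d: "d \<noteq> 0" "t b - d *s b \<in> U"
    using scalar[OF s] scalar[OF t] by blast
  \<comment> \<open>Modulo \<open>U\<close>, the scalars of \<open>r\<close> and \<open>q\<close> on
    \<open>b\<close> multiply under composition.\<close>
  have prod: "r (q b) - (e * f) *s b \<in> U"
    if r: "r \<in> carrier (lie_gal V U)" and e: "r b - e *s b \<in> U" and f: "q b - f *s b \<in> U"
    for r q e f
  proof -
    have "r (q b) = r ((q b - f *s b) + f *s b)" by simp
    also have "\<dots> = (q b - f *s b) + f *s r b"
      using lie_gal_add[OF r V, of "q b - f *s b" "f *s b"] lie_gal_fix[OF r V f]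
        lie_gal_scale[OF r V b(1)] f UV lie_subalgebra_closed(4)[OF V b(1) b(1)] by auto
    also have "\<dots> = (q b - f *s b) + f *s (r b - e *s b) + (e * f) *s b"
      by (simp add: scale_right_diff_distrib mult.commute)
    finally have "r (q b) - (e * f) *s b = (q b - f *s b) + f *s (r b - e *s b)" by simp
    then show ?thesis using e f lie_subalgebra_closed[OF U] by metis
  qed
  \<comment> \<open>Writing the commutator relation as k t s = s t avoids computing the scalars of
    the inverses.\<close>
  have "?k \<otimes>\<^bsub>lie_gal V U\<^esub> (t \<otimes>\<^bsub>lie_gal V U\<^esub> s) = s \<otimes>\<^bsub>lie_gal V U\<^esub> t"
    using s t by (simp add: G.m_assoc G.inv_solve_left' flip: G.m_assoc[of "inv\<^bsub>lie_gal V U\<^esub> t"]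
        G.m_assoc[of "inv\<^bsub>lie_gal V U\<^esub> s"])
  then have "compose V ?k (compose V t s) b = compose V s t b"
    using s t k by (metis lie_gal_mult G.m_closed)
  then have kst: "?k (t (s b)) = s (t b)" using b by (simp add: compose_eq)
  let ?u = "t (s b) - (c * d) *s b"
  \<comment> \<open>Commutativity of the field enters here: t s scales by \<open>d * c\<close> and s
    t by \<open>c * d\<close>. The remainder \<open>?u\<close> lies in \<open>U\<close>, so
    \<open>?k\<close> fixes it.\<close>
  have u: "?u \<in> U" using prod[where q = s, OF t d(2) c(2)] by (simp add: mult.commute)
  have "s (t b) = ?k (?u + (c * d) *s b)" using kst by simp
  also have "\<dots> = ?u + (c * d) *s ?k b"
    using lie_gal_add[OF k V, of ?u "(c * d) *s b"] lie_gal_fix[OF k V u]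
      lie_gal_scale[OF k V b(1)] u UV lie_subalgebra_closed(4)[OF V b(1) b(1)] by auto
  finally have "(s (t b) - (c * d) *s b) - ?u = (c * d) *s (?k b - b)"
    by (simp add: scale_right_diff_distrib)
  moreover have "(s (t b) - (c * d) *s b) - ?u \<in> U"
    using prod[where q = t, OF s c(2) d(2)] u lie_subalgebra_closed(2)[OF U] by blast
  \<comment> \<open>Cancelling the nonzero scalar \<open>c * d\<close> shows that \<open>?k\<close>
    acts on the class of \<open>b\<close> by 1.\<close>
  ultimately have "inverse (c * d) *s ((c * d) *s (?k b - b)) \<in> U"
    using lie_subalgebra_closed(4)[OF U] by metis
  moreover have "inverse (c * d) * (c * d) = 1"
    using c(1) d(1) by (intro left_inverse) simp
  ultimately have kb: "?k b - b \<in> U" by (metis scale_scale scale_one)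
  \<comment> \<open>Every \<open>x\<close> is a multiple of \<open>b\<close> plus an element of
    \<open>U\<close> fixed by \<open>?k\<close>, so the displacement of \<open>x\<close> is the same
    multiple of that of \<open>b\<close>.\<close>
  have "?k x - x \<in> U" if x: "x \<in> V" for x
  proof -
    obtain e where e: "x - e *s b \<in> U" using line[OF x] by blast
    have "?k x - ?k (e *s b) = x - e *s b"
      using lie_gal_fix[OF k V e] lie_gal_diff[OF k V x] lie_subalgebra_closed(4)[OF V b(1) b(1)]
      by simp
    then have "?k x - x = e *s (?k b - b)"
      using lie_gal_scale[OF k V b(1)] by (simp add: algebra_simps)
    then show ?thesis using kb lie_subalgebra_closed(4)[OF U] by metis
  qed
  then show ?thesis using k by (simp add: lie_gal_unip_def)
qed

text \<open>All commutators lie in the commutative subgroup \<open>lie_gal_unip V U\<close>, so the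
  derived subgroup is abelian and the group is metabelian.\<close>

lemma solvable_lie_gal_codim_one:
  assumes V: "lie_subalgebra V" and U: "lie_subalgebra U" and codim: "has_codim U V 1"
  shows "solvable (lie_gal V U)"
proof -
  have UV: "U \<subseteq> V" using codim by (simp add: has_codim_def)
  interpret G: group "lie_gal V U" using group_lie_gal[OF V UV] .
  let ?D = "derived (lie_gal V U) (carrier (lie_gal V U))"
  have "?D \<subseteq> lie_gal_unip V U"
    unfolding derived_def using commutator_in_lie_gal_unip[OF assms]
    by (intro G.generate_subgroup_incl[OF _ subgroup_lie_gal_unip[OF V U UV]]) auto
  then have "solvable_seq (lie_gal V U) ?D"
    using lie_gal_unip_commute[OF V UV]
    by (intro G.solvable_seq_commuting G.derived_is_subgroup) auto
  then show ?thesis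
    unfolding solvable_def by (rule G.augment_solvable_seq[OF G.subgroup_self])
qed

section \<open>Restriction to an intermediate subalgebra\<close>

lemma restrict_lie_gal:
  assumes V: "lie_subalgebra V" and W: "lie_subalgebra W" and UW: "U \<subseteq> W" and WV: "W \<subseteq> V"
    and inv: "\<And>s. s \<in> carrier (lie_gal V U) \<Longrightarrow> s ` W \<subseteq> W"
    and s: "s \<in> carrier (lie_gal V U)"
  shows "restrict s W \<in> carrier (lie_gal W U)"
proof -
  have UV: "U \<subseteq> V" using UW WV by blast
  interpret G: group "lie_gal V U" using group_lie_gal[OF V UV] .
  have "W \<subseteq> s ` W"
  proof
    fix x assume x: "x \<in> W"
    then have "(inv\<^bsub>lie_gal V U\<^esub> s) x \<in> W" using inv[OF G.inv_closed[OF s]] by blast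
    then show "x \<in> s ` W" using lie_gal_inv_cancel[OF V UV s] x WV by (metis image_eqI subsetD)
  qed
  then have "bij_betw s W W"
    using inv[OF s] inj_on_subset[OF _ WV] lie_gal_bij_betw[OF s V] by (auto simp: bij_betw_def)
  then have "restrict s W \<in> Bij W" by (simp add: Bij_def)
  then show ?thesis
    using lie_galD[OF s V] lie_subalgebra_closed[OF W] UW WV
    by (auto simp: lie_gal_def lie_auts_def subset_iff)
qed

text \<open>Restriction to \<open>W\<close> need not be surjective, but its image is a subgroup of a
  solvable group. Its kernel fixes \<open>W\<close> pointwise, so the group is an extension of a
  solvable group by a solvable group.\<close>

lemma solvable_lie_gal_tower:
  assumes V: "lie_subalgebra V" and W: "lie_subalgebra W" and UW: "U \<subseteq> W" and WV: "W \<subseteq> V"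
    and inv: "\<And>s. s \<in> carrier (lie_gal V U) \<Longrightarrow> s ` W \<subseteq> W"
    and solvW: "solvable (lie_gal W U)" and solvV: "solvable (lie_gal V W)"
  shows "solvable (lie_gal V U)"
proof -
  have UV: "U \<subseteq> V" using UW WV by blast
  interpret VU: group "lie_gal V U" using group_lie_gal[OF V UV] .
  interpret WU: group "lie_gal W U" using group_lie_gal[OF W UW] .
  interpret VW: group "lie_gal V W" using group_lie_gal[OF V WV] .
  let ?r = "\<lambda>s. restrict s W"
  have r: "?r s \<in> carrier (lie_gal W U)" if "s \<in> carrier (lie_gal V U)" for s
    using restrict_lie_gal[OF V W UW WV inv that] .
  interpret r: group_hom "lie_gal V U" "lie_gal W U" ?r
  proof (unfold_locales, rule homI)
    fix s t assume st: "s \<in> carrier (lie_gal V U)" "t \<in> carrier (lie_gal V U)"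
    have "restrict (compose V s t) W = compose W (restrict s W) (restrict t W)"
      using WV inv[OF st(2)] by (auto simp: compose_def restrict_def fun_eq_iff)
    then show "?r (s \<otimes>\<^bsub>lie_gal V U\<^esub> t) = ?r s \<otimes>\<^bsub>lie_gal W U\<^esub> ?r t"
      using st r by (simp add: lie_gal_mult)
  qed (use r in auto)
  have sub: "carrier (lie_gal V W) \<subseteq> carrier (lie_gal V U)"
    using UW by (auto simp: lie_gal_def)
  \<comment> \<open>The criterion \<open>solvable_seq_condition\<close> works with two composable
    homomorphisms, so the inclusion of the kernel is presented as the homomorphism
    \<open>id\<close>.\<close>
  have incl: "group_hom (lie_gal V W) (lie_gal V U) id"
    using sub by unfold_locales (auto simp: hom_def lie_gal_mult subset_iff)
  have "kernel (lie_gal V U) (lie_gal W U) ?r \<subseteq> id ` carrier (lie_gal V W)"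
  proof
    fix s assume "s \<in> kernel (lie_gal V U) (lie_gal W U) ?r"
    then have s: "s \<in> carrier (lie_gal V U)" and eq: "restrict s W = (\<lambda>x\<in>W. x)"
      by (auto simp: kernel_def lie_gal_one)
    have "s x = x" if "x \<in> W" for x using eq that by (metis restrict_apply')
    then show "s \<in> id ` carrier (lie_gal V W)" using s by (simp add: lie_gal_def)
  qed
  moreover have "solvable_seq (lie_gal W U) (?r ` carrier (lie_gal V U))"
    using WU.solvable_subgroup[OF r.img_is_subgroup solvW] .
  ultimately show ?thesis
    using solvable_seq_condition[OF incl r.group_hom_axioms, of "carrier (lie_gal V W)"
        "carrier (lie_gal V U)"] sub solvV VU.subgroup_self
    by (simp add: solvable_def)
qed

section \<open>Induction along the chain\<close>

lemma solvable_lie_gal_self: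
  assumes "lie_subalgebra U"
  shows "solvable (lie_gal U U)"
proof -
  interpret G: group "lie_gal U U" using group_lie_gal[OF assms] by simp
  \<comment> \<open>Fixing all of \<open>U\<close> leaves only one automorphism, so the group is
    trivial.\<close>
  have "s = t" if "s \<in> carrier (lie_gal U U)" "t \<in> carrier (lie_gal U U)" for s t
    using that by (intro lie_gal_eqI[OF that assms]) (simp add: lie_gal_fix[OF _ assms])
  then show ?thesis
    unfolding solvable_def by (intro G.solvable_seq_commuting G.subgroup_self) blast
qed

lemma solvable_lie_gal_radical:
  assumes "radical_extension U V"
  shows "solvable (lie_gal V U)"
proof -
  obtain m H where H0: "H 0 = U" and Hm: "H m = V"
    and sub: "\<And>i. i \<le> m \<Longrightarrow> lie_subalgebra (H i)"
    and codim: "\<And>i. i < m \<Longrightarrow> has_codim (H i) (H (Suc i)) 1"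
    and inv: "\<forall>i\<in>{1..m}. \<forall>\<tau>\<in>carrier (lie_gal (H i) U). \<tau> ` H (i - 1) \<subseteq> H (i - 1)"
    using assms unfolding radical_extension_def by blast
  \<comment> \<open>The inclusion of \<open>U\<close> is carried along because the chain only
    relates neighbouring members, whereas the tower step needs \<open>U\<close> inside
    \<open>H i\<close>.\<close>
  have "i \<le> m \<Longrightarrow> U \<subseteq> H i \<and> solvable (lie_gal (H i) U)" for i
  proof (induction i)
    case 0
    then show ?case using H0 sub[of 0] solvable_lie_gal_self by simp
  next
    case (Suc i)
    then have IH: "U \<subseteq> H i" "solvable (lie_gal (H i) U)" and i: "i < m" by auto
    have step: "H i \<subseteq> H (Suc i)" using codim[OF i] by (simp add: has_codim_def)
    have "s ` H i \<subseteq> H i" if "s \<in> carrier (lie_gal (H (Suc i)) U)" for s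
      \<comment> \<open>The invariance condition is indexed by the larger algebra, so
        \<open>Suc i\<close> gives invariance of \<open>H i\<close>.\<close>
      using bspec[OF inv, of "Suc i"] i that by simp
    moreover have "solvable (lie_gal (H (Suc i)) (H i))"
      using solvable_lie_gal_codim_one[OF sub sub codim[OF i]] i by simp
    ultimately show ?case
      using solvable_lie_gal_tower[OF sub sub IH(1) step _ IH(2)] IH(1) step i by auto
  qed
  then show ?thesis using Hm by blast
qed

end

theorem theorem4p4:
  fixes scale :: "'k::field \<Rightarrow> 'a::ab_group_add \<Rightarrow> 'a"
    and bracket :: "'a \<Rightarrow> 'a \<Rightarrow> 'a"
    and \<gg> \<hh> :: "'a set"
  assumes "lie_algebra scale bracket"
    and "lie_algebra.lie_subalgebra scale bracket \<hh>"
    and "lie_algebra.finite_dim scale \<hh>"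
    and "lie_algebra.lie_subalgebra scale bracket \<gg>"
    and "\<gg> \<subseteq> \<hh>"
    and "lie_algebra.radical_extension scale bracket \<gg> \<hh>"
  shows "solvable (lie_algebra.lie_gal scale bracket \<hh> \<gg>)"
  using lie_algebra.solvable_lie_gal_radical assms by blast

end
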